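(* Let $d\geq 1$ be an integer such that $g(d)<\tau^{-2}$. Then the longest length $A(d)$ of a monochromatic arithmetic progression of difference $d$ in the Fibonacci word satisfies \[ A(d)=\left\lfloor\frac{\tau^{-1}}{g(d)}\right\rfloor+1=\left\lceil\frac{\tau^{-1}}{g(d)}\right\rceil . \]
   Context: Let $\tau=\frac12(1+\sqrt5)$ and let $\{x\}=x-\lfloor x\rfloor$ denote the fractional part of a real number $x$. For an integer $d\ge 1$ let $g(d)=\min(\{d\tau\},\,1-\{d\tau\})$ (the distance from $d\tau$ to the nearest integer). The Fibonacci word $\mathbf f=(f_i)_{i\ge 0}$ is the unique infinite word over $\{\mathtt 0,\mathtt 1\}$ fixed by the substitution $\mathtt 0\mapsto \mathtt{01},\ \mathtt 1\mapsto \mathtt 0$, i.e. $\mathbf f=\mathtt{0100101001001}\cdots$. A monochromatic arithmetic progression (MAP) of difference $d$ and length $\ell$ in $\mathbf f$ starting at position $i\geq 0$ means $f_i=f_{i+d}=f_{i+2d}=\cdots=f_{i+(\ell-1)d}$. For $d\ge1$, $A(d)$ is the maximum $\ell$ such that a MAP of difference $d$ and length $\ell$ occurs in $\mathbf f$ (with $A(d)=\infty$ if no finite maximum exists). *)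

theory Defs
  imports Complex_Main "HOL-Library.Stream" "HOL-Library.Extended_Nat"
begin

definition tau :: real where
  "tau = (1 + sqrt 5) / 2"

definition g :: "nat \<Rightarrow> real" where
  "g d = min (frac (real d * tau)) (1 - frac (real d * tau))"

datatype letter = L0 | L1

fun fib_subst :: "letter \<Rightarrow> letter list" where
  "fib_subst L0 = [L0, L1]"
| "fib_subst L1 = [L0]"

text \<open>The substitution extended to infinite words: the concatenation of the images of the letters.\<close>

definition fib_subst_inf :: "letter stream \<Rightarrow> letter stream" where
  "fib_subst_inf w = flat (smap fib_subst w)"

definition fib_word :: "letter stream" where
  "fib_word = (THE w. fib_subst_inf w = w)"

definition is_MAP :: "nat \<Rightarrow> nat \<Rightarrow> nat \<Rightarrow> bool" where
  "is_MAP d l i \<longleftrightarrow> l \<ge> 1 \<and> (\<forall>j<l. fib_word !! (i + j * d) = fib_word !! i)"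

text \<open>A supremum in \<open>enat\<close> of a nonempty set of naturals: it is the maximum if
  the set is finite and \<open>\<infinity>\<close> otherwise.\<close>

definition A :: "nat \<Rightarrow> enat" where
  "A d = Sup {enat l | l. \<exists>i. is_MAP d l i}"

text \<open>The remaining facts show that \<open>fib_word\<close> is well defined: the substitution has
  exactly one infinite fixed point.\<close>

lemma fib_subst_ne [simp]: "fib_subst a \<noteq> []"
  by (cases a) auto

lemma fib_subst_inf_Cons: "fib_subst_inf (a ## w) = fib_subst a @- fib_subst_inf w"
  by (simp add: fib_subst_inf_def)

lemma fib_subst_inf_shift:
  "fib_subst_inf (xs @- w) = concat (map fib_subst xs) @- fib_subst_inf w"
  by (induction xs) (simp_all add: fib_subst_inf_Cons)

lemma length_concat_fib_subst: "length xs \<le> length (concat (map fib_subst xs))"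
proof (induction xs)
  case (Cons a xs)
  then show ?case by (cases a) auto
qed simp

lemma fib_fixed_shd:
  assumes "fib_subst_inf w = w"
  shows "shd w = L0"
proof -
  have "shd (fib_subst_inf w) = L0"
    by (cases "shd w") (simp_all add: fib_subst_inf_def)
  then show ?thesis using assms by simp
qed

lemma stream_eqI_snth:
  assumes "\<And>n. u !! n = v !! n"
  shows "u = v"
proof -
  have "(!!) u = (!!) v" using assms by auto
  then show ?thesis by (metis stream_smap_nats)
qed

lemma fib_fixed_unique:
  assumes u: "fib_subst_inf u = u" and v: "fib_subst_inf v = v"
  shows "u = v"
proof -
  have st: "stake (Suc n) u = stake (Suc n) v" for n
  proof (induction n)
    case 0
    then show ?case using fib_fixed_shd[OF u] fib_fixed_shd[OF v] by simp
  next
    case (Suc n)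
    define xs where "xs = stake (Suc n) u"
    define ys where "ys = concat (map fib_subst xs)"
    have xs: "xs = L0 # stake n (stl u)"
      using fib_fixed_shd[OF u] by (simp add: xs_def)
    have len: "Suc (Suc n) \<le> length ys"
      using length_concat_fib_subst[of "stake n (stl u)"] by (simp add: ys_def xs)
    have "u = ys @- fib_subst_inf (sdrop (Suc n) u)"
      using fib_subst_inf_shift[of xs "sdrop (Suc n) u"] u
      by (metis stake_sdrop xs_def ys_def)
    moreover have "v = ys @- fib_subst_inf (sdrop (Suc n) v)"
      using fib_subst_inf_shift[of xs "sdrop (Suc n) v"] v Suc
      by (metis stake_sdrop xs_def ys_def)
    ultimately show ?case using len
      by (metis stake_shift diff_is_0_eq stake.simps(1))
  qed
  have "u !! n = v !! n" for n
    using st[of n] by (metis stake_nth lessI)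
  then show ?thesis
    by (rule stream_eqI_snth)
qed

lemma fib_fixed_exists: "\<exists>w. fib_subst_inf w = w"
proof -
  define X where "X = (\<lambda>n. ((\<lambda>xs. concat (map fib_subst xs)) ^^ n) [L0])"
  have X0: "X 0 = [L0]" and XS: "X (Suc n) = concat (map fib_subst (X n))" for n
    by (simp_all add: X_def)
  have ext: "\<exists>ys. X (Suc n) = X n @ ys \<and> ys \<noteq> []" for n
  proof (induction n)
    case 0
    then show ?case by (simp add: X0 XS)
  next
    case (Suc n)
    then obtain ys where ys: "X (Suc n) = X n @ ys" "ys \<noteq> []" by blast
    have "X (Suc (Suc n)) = X (Suc n) @ concat (map fib_subst ys)"
      by (metis XS ys(1) concat_append map_append)
    moreover have "concat (map fib_subst ys) \<noteq> []"
      using ys(2) by (cases ys) auto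
    ultimately show ?case by blast
  qed
  have len: "n < length (X n)" for n
  proof (induction n)
    case (Suc n)
    obtain ys where "X (Suc n) = X n @ ys" "ys \<noteq> []" using ext by blast
    with Suc show ?case by (cases ys) auto
  qed (simp add: X0)
  have mono: "\<exists>ys. X (n + k) = X n @ ys" for n k
  proof (induction k)
    case (Suc k)
    then show ?case using ext[of "n + k"] by auto
  qed simp
  define w where "w = smap (\<lambda>i. X i ! i) nats"
  have w: "w !! i = X n ! i" if "i < length (X n)" for i n
  proof (cases "i \<le> n")
    case True
    then obtain ys where "X n = X i @ ys" using mono[of i "n - i"] by auto
    then show ?thesis using len[of i] by (simp add: w_def nth_append)
  next
    case False
    then obtain ys where "X i = X n @ ys" using mono[of n "i - n"] by auto
    then show ?thesis using that by (simp add: w_def nth_append)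
  qed
  have pre: "w = X n @- sdrop (length (X n)) w" for n
  proof -
    have "stake (length (X n)) w = X n"
      by (rule nth_equalityI) (simp_all add: w)
    then show ?thesis by (metis stake_sdrop)
  qed
  have "fib_subst_inf w !! n = w !! n" for n
  proof -
    have "fib_subst_inf w = X (Suc n) @- fib_subst_inf (sdrop (length (X n)) w)"
      by (metis pre XS fib_subst_inf_shift)
    moreover have "n < length (X (Suc n))" using len[of "Suc n"] by simp
    ultimately show ?thesis using w by simp
  qed
  then show ?thesis using stream_eqI_snth by blast
qed

lemma fib_word_ex1: "\<exists>!w. fib_subst_inf w = w"
  using fib_fixed_exists fib_fixed_unique by blast

lemma fib_word_fixed: "fib_subst_inf fib_word = fib_word"
  unfolding fib_word_def by (rule theI'[OF fib_word_ex1])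

end

theory Submission
  imports Defs "HOL-Analysis.Kronecker_Approximation_Theorem"
begin

text \<open>The Fibonacci word codes the orbit of the rotation by \<open>\<tau>\<close> on the circle: the letter at
  position \<open>i\<close> is \<open>0\<close> exactly when \<open>(i+1)\<tau>\<close> lies in the arc \<open>[\<tau>\<^sup>-\<^sup>2, 1)\<close> of length \<open>\<tau>\<^sup>-\<^sup>1\<close>; this
  word is a fixed point of the substitution. A MAP of difference \<open>d\<close> is an orbit segment of the
  rotation by \<open>d\<tau>\<close>, whose signed step has size \<open>g(d) < \<tau>\<^sup>-\<^sup>2\<close>, too short to jump over either of the
  two arcs. Hence the segment stays in one arc and runs through it monotonically, which gives
  \<open>(\<ell>-1) g(d) < \<tau>\<^sup>-\<^sup>1\<close>. Conversely, by density of the orbit, every such \<open>\<ell>\<close> is realised inside the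
  longer arc.\<close>

section \<open>Arithmetic and irrationality of the golden ratio\<close>

lemma tau_sq: "tau * tau = tau + 1"
  by (simp add: tau_def field_simps)

lemma tau_bounds: "8/5 < tau" "tau < 17/10"
proof -
  have "11/5 < sqrt 5" by (rule real_less_rsqrt) (simp add: power2_eq_square)
  then show "8/5 < tau" by (simp add: tau_def)
  have "sqrt 5 < 12/5" by (rule real_less_lsqrt) (simp_all add: power2_eq_square)
  then show "tau < 17/10" by (simp add: tau_def)
qed

text \<open>Expressing the inverse powers linearly in \<open>tau\<close> leaves the later
  comparisons to linear arithmetic.\<close>

lemma tau_powi_m1: "tau powi (-1) = tau - 1"
  using tau_sq tau_bounds by (simp add: power_int_minus field_simps)

lemma tau_powi_m2: "tau powi (-2) = 2 - tau"
proof -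
  have "tau powi (-2) = (tau - 1) * (tau - 1)"
    using tau_powi_m1 by (simp add: power_int_minus power2_eq_square)
  then show ?thesis using tau_sq by (simp add: algebra_simps)
qed

text \<open>In lowest terms, \<open>tau * tau = tau + 1\<close> makes the denominator divide the
  square of the numerator, so it is 1; but no integer lies strictly between 1 and 2.\<close>

lemma tau_irrational: "tau \<notin> \<rat>"
proof
  assume "tau \<in> \<rat>"
  then obtain a b :: int where ab: "b > 0" "coprime a b" "tau = of_int a / of_int b"
    by (metis Rats_cases')
  have "real_of_int (a * a) = real_of_int (b * (a + b))"
    using tau_sq ab(1) by (simp add: ab(3) field_simps)
  then have "a * a = b * (a + b)" by linarith
  then have "b dvd a * a" by simp
  moreover have "coprime b (a * a)" using ab(2) by (simp add: coprime_commute)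
  ultimately have "b = 1" using ab(1)
    by (metis coprime_absorb_left zdvd1_eq abs_of_pos)
  then have "1 < a" "a < 2" using ab(3) tau_bounds by simp_all
  then show False by simp
qed

lemma mult_tau_neq_int: "n > 0 \<Longrightarrow> real n * tau \<noteq> of_int k"
proof
  assume "n > 0" "real n * tau = of_int k"
  then have "tau = of_int k / of_int (int n)" by (simp add: field_simps)
  then show False using tau_irrational by (metis Rats_divide Rats_of_int)
qed

section \<open>The Fibonacci word as the coding of a rotation\<close>

lemma floor_Suc_mult_tau_ge_1: "\<lfloor>real (Suc n) * tau\<rfloor> \<ge> 1"
proof -
  have "1 * tau \<le> real (Suc n) * tau" using tau_bounds by (intro mult_right_mono) auto
  then have "1 \<le> real (Suc n) * tau" using tau_bounds by linarith
  then show ?thesis by (simp only: le_floor_iff of_int_1)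
qed

definition rotation_word :: "letter stream" where
  "rotation_word = smap (\<lambda>i. if frac (real (Suc i) * tau) \<ge> 2 - tau then L0 else L1) nats"

lemma rotation_word_nth:
  "rotation_word !! i = (if frac (real (Suc i) * tau) \<ge> 2 - tau then L0 else L1)"
  by (simp add: rotation_word_def)

text \<open>\<open>k\<close> is where the image of letter \<open>n\<close> begins. If
  \<open>(n + 1) * tau = q + x\<close>, then \<open>tau * tau = tau + 1\<close> gives
  \<open>q * tau\<close> the fractional part \<open>1 - x * (tau - 1)\<close>, which lies in the
  long arc. One further rotation reaches the short arc when \<open>x \<ge> 2 - tau\<close>, that is,
  when letter \<open>n\<close> is \<open>L0\<close>.\<close>

lemma rotation_word_image:
  fixes n :: nat
  defines "k \<equiv> nat (\<lfloor>real (Suc n) * tau\<rfloor> - 1)"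
  assumes "j < length (fib_subst (rotation_word !! n))"
  shows "fib_subst (rotation_word !! n) ! j = rotation_word !! (k + j)"
proof -
  define x where "x = frac (real (Suc n) * tau)"
  define q where "q = \<lfloor>real (Suc n) * tau\<rfloor>"
  have eq: "real (Suc n) * tau = q + x" by (simp add: x_def q_def frac_def)
  have q: "q \<ge> 1" using floor_Suc_mult_tau_ge_1 by (simp only: q_def)
  then have k: "real (Suc k) = real_of_int q" by (simp add: k_def q_def[symmetric] del: of_nat_Suc)
  have x: "0 \<le> x" "x < 1" by (simp_all add: x_def frac_lt_1)
  have x0: "x \<noteq> 0" using eq mult_tau_neq_int[of "Suc n" q] by auto
  have "real (Suc n) * (tau * tau) = (q + x) * tau" unfolding eq[symmetric] by simp
  then have qtau: "q * tau = of_int (q + int (Suc n)) - x * (tau - 1)"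
    using eq unfolding tau_sq by (simp add: algebra_simps)
  have y: "0 < x * (tau - 1)" "x * (tau - 1) < tau - 1"
    using x x0 tau_bounds mult_strict_right_mono[of x 1 "tau - 1"] by auto
  have "frac (real (Suc k) * tau) = 1 - x * (tau - 1)"
    unfolding k qtau frac_unique_iff
  proof (intro conjI)
    show "0 \<le> 1 - x * (tau - 1)" "1 - x * (tau - 1) < 1" using y tau_bounds by linarith+
  qed simp
  then have A0: "rotation_word !! k = L0" using y by (simp add: rotation_word_nth)
  have A1: "rotation_word !! Suc k = L1" if "x \<ge> 2 - tau"
  proof -
    \<comment> \<open>Equality would make \<open>(n + 2) * tau\<close> the integer
      \<open>q + 2\<close>.\<close>
    have "x \<noteq> 2 - tau"
      using eq mult_tau_neq_int[of "Suc (Suc n)" "q + 2"] by (auto simp: algebra_simps)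
    then have "(tau - 1) * (2 - tau) < (tau - 1) * x"
      using that tau_bounds by (intro mult_strict_left_mono) auto
    moreover have "(tau - 1) * (2 - tau) = 2 * tau - 3" using tau_sq by (simp add: algebra_simps)
    ultimately have z: "tau - 1 - x * (tau - 1) < 2 - tau" by (simp add: algebra_simps)
    have s: "real (Suc (Suc k)) * tau = of_int (q + int (Suc n) + 1) + (tau - 1 - x * (tau - 1))"
      using k qtau by (simp add: algebra_simps)
    have "frac (real (Suc (Suc k)) * tau) = tau - 1 - x * (tau - 1)"
      unfolding s frac_unique_iff
    proof (intro conjI)
      show "0 \<le> tau - 1 - x * (tau - 1)" "tau - 1 - x * (tau - 1) < 1"
        using y z tau_bounds by linarith+
    qed simp
    then show ?thesis using z unfolding rotation_word_nth by simp
  qed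
  show ?thesis
  proof (cases "x \<ge> 2 - tau")
    case True
    then have "rotation_word !! n = L0" by (simp add: rotation_word_nth x_def)
    then have "fib_subst (rotation_word !! n) = [L0, L1]" by simp
    then show ?thesis using assms(2) A0 A1[OF True] by (auto simp: less_Suc_eq)
  next
    case False
    then have "rotation_word !! n = L1" by (simp add: rotation_word_nth x_def)
    then have "fib_subst (rotation_word !! n) = [L0]" by simp
    then show ?thesis using assms(2) A0 by auto
  qed
qed

text \<open>Consecutive images abut: adding \<open>tau\<close> raises the floor by 2 exactly when
  \<open>x \<ge> 2 - tau\<close>, where the image has length 2, and by 1 otherwise.\<close>

lemma rotation_word_image_length:
  "nat (\<lfloor>real (Suc n) * tau\<rfloor> - 1) + length (fib_subst (rotation_word !! n))
    = nat (\<lfloor>real (Suc (Suc n)) * tau\<rfloor> - 1)"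
proof -
  define x where "x = frac (real (Suc n) * tau)"
  define q where "q = \<lfloor>real (Suc n) * tau\<rfloor>"
  have eq: "real (Suc n) * tau = q + x" by (simp add: x_def q_def frac_def)
  have q: "q \<ge> 1" using floor_Suc_mult_tau_ge_1 by (simp only: q_def)
  have x: "0 \<le> x" "x < 1" by (simp_all add: x_def frac_lt_1)
  have "real (Suc (Suc n)) * tau = q + x + tau" using eq by (simp add: algebra_simps)
  then have fl: "\<lfloor>real (Suc (Suc n)) * tau\<rfloor> = (if x \<ge> 2 - tau then q + 2 else q + 1)"
    using x tau_bounds by (auto simp: floor_eq_iff)
  show ?thesis
    unfolding fl q_def[symmetric] using q by (simp add: rotation_word_nth x_def[symmetric] del: of_nat_Suc) linarith
qed

text \<open>With \<open>n\<close> arbitrary, the induction on \<open>j\<close> can peel off one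
  image at a time; \<open>j\<close> decreases because images are nonempty.\<close>

lemma fib_subst_inf_sdrop_rotation_word:
  "fib_subst_inf (sdrop n rotation_word) !! j
    = rotation_word !! (nat (\<lfloor>real (Suc n) * tau\<rfloor> - 1) + j)"
proof (induction j arbitrary: n rule: less_induct)
  case (less j)
  define u where "u = fib_subst (rotation_word !! n)"
  have u: "length u > 0" by (simp add: u_def)
  have "sdrop n rotation_word = rotation_word !! n ## sdrop (Suc n) rotation_word"
    by (metis sdrop_simps stream.collapse)
  then have e: "fib_subst_inf (sdrop n rotation_word)
      = u @- fib_subst_inf (sdrop (Suc n) rotation_word)"
    by (simp add: fib_subst_inf_Cons u_def del: sdrop.simps)
  show ?case
  proof (cases "j < length u")
    case True
    then show ?thesis using rotation_word_image[of j n] by (simp add: e u_def del: sdrop.simps)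
  next
    case False
    then have "fib_subst_inf (sdrop n rotation_word) !! j
        = fib_subst_inf (sdrop (Suc n) rotation_word) !! (j - length u)"
      by (simp add: e del: sdrop.simps)
    also have "\<dots> = rotation_word !! (nat (\<lfloor>real (Suc (Suc n)) * tau\<rfloor> - 1) + (j - length u))"
      using False u by (intro less.IH) linarith
    also have "nat (\<lfloor>real (Suc (Suc n)) * tau\<rfloor> - 1) + (j - length u)
        = nat (\<lfloor>real (Suc n) * tau\<rfloor> - 1) + j"
      using False rotation_word_image_length[of n] unfolding u_def by linarith
    finally show ?thesis .
  qed
qed

lemma fib_word_eq_rotation_word: "fib_word = rotation_word"
proof (rule fib_fixed_unique[OF fib_word_fixed], rule stream_eqI_snth)
  \<comment> \<open>With nothing dropped, the offset \<open>\<lfloor>tau\<rfloor> - 1\<close> is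
    0.\<close>
  have "\<lfloor>tau\<rfloor> = 1" using tau_bounds by (simp add: floor_eq_iff)
  then show "fib_subst_inf rotation_word !! n = rotation_word !! n" for n
    using fib_subst_inf_sdrop_rotation_word[of 0 n] by simp
qed

lemma fib_word_nth_eq_iff:
  "fib_word !! i = fib_word !! j \<longleftrightarrow>
    (frac (real (Suc i) * tau) \<ge> 2 - tau \<longleftrightarrow> frac (real (Suc j) * tau) \<ge> 2 - tau)"
  by (simp add: fib_word_eq_rotation_word rotation_word_nth)

section \<open>Upper bound for the length of a progression, and its realisation\<close>

lemma g_signed_step:
  obtains s :: real and m :: int where "real d * tau = m + s" "\<bar>s\<bar> = g d"
proof (cases "frac (real d * tau) \<le> 1 - frac (real d * tau)")
  case True
  show thesis
    by (rule that[of "\<lfloor>real d * tau\<rfloor>" "frac (real d * tau)"]) (use True in \<open>auto simp: g_def frac_def\<close>)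
next
  case False
  show thesis
    by (rule that[of "\<lfloor>real d * tau\<rfloor> + 1" "frac (real d * tau) - 1"])
      (use False frac_lt_1[of "real d * tau"] in \<open>auto simp: g_def frac_def abs_if min_def\<close>)
qed

lemma g_pos: "d > 0 \<Longrightarrow> g d > 0"
  using mult_tau_neq_int[of d] by (auto simp: g_def frac_lt_1 elim!: Ints_cases)

lemma MAP_length_less:
  assumes small: "g d < 2 - tau" and MAP: "is_MAP d l i"
  shows "real (l - 1) * g d < tau - 1"
proof -
  obtain s m where s: "real d * tau = of_int m + s" "\<bar>s\<bar> = g d" by (rule g_signed_step)
  define x where "x = frac (real (Suc i) * tau)"
  \<comment> \<open>The arc containing \<open>x\<close>, as a real interval. The orbit is followed
    as \<open>x + j * s\<close> without reduction modulo 1, so that its total displacement can be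
    read off.\<close>
  define I where "I = (if x \<ge> 2 - tau then {2 - tau..<1} else {0..<2 - tau})"
  have pos: "real (Suc (i + j * d)) * tau = real (Suc i) * tau + real j * s + of_int (int j * m)" for j
  proof -
    have "real (Suc (i + j * d)) * tau = real (Suc i) * tau + real j * (real d * tau)"
      by (simp add: algebra_simps)
    then show ?thesis unfolding s(1) by (simp add: algebra_simps)
  qed
  have fr: "frac (real (Suc (i + j * d)) * tau) = frac (x + real j * s)" for j
  proof -
    have "real (Suc (i + j * d)) * tau
        = x + real j * s + of_int (int j * m + \<lfloor>real (Suc i) * tau\<rfloor>)"
      unfolding pos x_def frac_def by simp
    then show ?thesis by (metis frac_add_of_int_right)
  qed
  have x: "0 \<le> x" "x < 1" by (simp_all add: x_def frac_lt_1)
  have inI: "x + real j * s \<in> I" if "j < l" for j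
    using that
  proof (induction j)
    case 0
    then show ?case using x by (simp add: I_def)
  next
    case (Suc j)
    define z where "z = x + real j * s"
    have z: "z \<in> I" using Suc by (simp add: z_def)
    have z': "x + real (Suc j) * s = z + s" by (simp add: z_def algebra_simps)
    have "fib_word !! (i + Suc j * d) = fib_word !! i" using MAP Suc.prems unfolding is_MAP_def by blast
    then have same: "frac (z + s) \<ge> 2 - tau \<longleftrightarrow> x \<ge> 2 - tau"
      using fr[of "Suc j"] unfolding fib_word_nth_eq_iff z' x_def[symmetric] by simp
    have f0: "frac (z + s) = z + s" if "0 \<le> z + s" "z + s < 1"
      using that by (simp add: frac_eq)
    have f1: "frac (z + s) = z + s - 1" if "1 \<le> z + s" "z + s < 2"
      using that by (simp add: frac_unique_iff)
    have f2: "frac (z + s) = z + s + 1" if "-1 \<le> z + s" "z + s < 0"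
      using that by (simp add: frac_unique_iff)
    \<comment> \<open>A step shorter than \<open>2 - tau\<close> that left \<open>I\<close> would
      land in the other arc, contradicting \<open>same\<close>.\<close>
    have "z + s \<in> I"
    proof (cases "x \<ge> 2 - tau")
      case True
      then have "2 - tau \<le> z" "z < 1" using z by (auto simp: I_def)
      moreover from this have "0 \<le> z + s" "z + s < 2" using small s(2) tau_bounds by linarith+
      ultimately have "2 - tau \<le> z + s" "z + s < 1"
        using f0 f1 same True small s(2) by linarith+
      then show ?thesis using True by (simp add: I_def)
    next
      case False
      then have "0 \<le> z" "z < 2 - tau" using z by (auto simp: I_def)
      moreover from this have "-1 \<le> z + s" "z + s < 1" using small s(2) tau_bounds by linarith+
      ultimately have "0 \<le> z + s" "z + s < 2 - tau"
        using f0 f2 same False small s(2) tau_bounds by linarith+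
      then show ?thesis using False by (simp add: I_def)
    qed
    then show ?case by (simp only: z')
  qed
  have "l \<ge> 1" using MAP by (simp add: is_MAP_def)
  then have "x + real (l - 1) * s \<in> I" "x \<in> I" using inI[of "l - 1"] inI[of 0] by simp_all
  \<comment> \<open>Both arcs are half-open of length at most \<open>tau - 1\<close>.\<close>
  then have "\<bar>real (l - 1) * s\<bar> < tau - 1"
    using tau_bounds by (auto simp: I_def split: if_splits)
  then show ?thesis by (simp add: abs_mult s(2))
qed

lemma MAP_exists:
  assumes "l \<ge> 1" and len: "real (l - 1) * g d < tau - 1"
  shows "\<exists>i. is_MAP d l i"
proof -
  obtain s m where s: "real d * tau = of_int m + s" "\<bar>s\<bar> = g d" by (rule g_signed_step)
  define r where "r = real (l - 1) * s"
  have r: "\<bar>r\<bar> < tau - 1" using len by (simp add: r_def abs_mult s(2))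
  \<comment> \<open>The midpoint of the set of \<open>x\<close> with both \<open>x\<close> and \<open>x + r\<close> in the arc.\<close>
  define c where "c = (3 - tau - r) / 2"
  \<comment> \<open>Half the length of that set.\<close>
  define e where "e = (tau - 1 - \<bar>r\<bar>) / 2"
  have "0 \<le> c" "c \<le> 1" "e > 0"
    using r tau_bounds by (auto simp: c_def e_def)
  then obtain k where k: "k > 0" "\<bar>frac (real k * tau) - c\<bar> < e"
    using Kronecker_approx_1_explicit[OF tau_irrational] by blast
  \<comment> \<open>Letter \<open>i\<close> is read at \<open>(i + 1) * tau\<close>, hence the
    shift.\<close>
  define i where "i = k - 1"
  have i: "Suc i = k" using k(1) by (simp add: i_def)
  define x where "x = frac (real k * tau)"
  have x: "2 - tau < x" "x < 1" "2 - tau < x + r" "x + r < 1"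
  proof -
    have "x - c < e" "c - x < e" using k(2) by (simp_all add: x_def abs_less_iff)
    then have "2 * x < 2 - r - \<bar>r\<bar>" "4 - 2 * tau < 2 * x + r - \<bar>r\<bar>"
      by (simp_all add: c_def e_def field_simps)
    then show "2 - tau < x" "x < 1" "2 - tau < x + r" "x + r < 1"
      by (smt (verit))+
  qed
  have "frac (real (Suc (i + j * d)) * tau) \<ge> 2 - tau" if "j < l" for j
  proof -
    have "real (Suc (i + j * d)) * tau = real k * tau + real j * (real d * tau)"
      using i by (simp add: algebra_simps flip: i)
    also have "\<dots> = x + real j * s + of_int (\<lfloor>real k * tau\<rfloor> + int j * m)"
      unfolding s(1) x_def frac_def by (simp add: algebra_simps)
    finally have fr: "frac (real (Suc (i + j * d)) * tau) = frac (x + real j * s)"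
      by (metis frac_add_of_int_right)
    have "real j \<le> real (l - 1)" using that by simp
    \<comment> \<open>Intermediate displacements lie between 0 and \<open>r\<close>, so control of
      the two end points suffices.\<close>
    then have "min 0 r \<le> real j * s \<and> real j * s \<le> max 0 r"
      using mult_right_mono[of "real j" "real (l - 1)" s]
        mult_right_mono_neg[of "real j" "real (l - 1)" s]
        mult_nonneg_nonneg[of "real j" s] mult_nonneg_nonpos[of "real j" s]
      unfolding r_def by linarith
    then have "2 - tau < x + real j * s" "x + real j * s < 1"
      using x by linarith+
    moreover from this have "frac (x + real j * s) = x + real j * s"
      using tau_bounds by (simp add: frac_eq)
    ultimately show ?thesis using fr by simp
  qed
  from this[of 0] this have "is_MAP d l i"
    using assms(1) by (simp add: is_MAP_def fib_word_nth_eq_iff)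
  then show ?thesis ..
qed

section \<open>Agreement of floor and ceiling, and the maximal length\<close>

text \<open>If \<open>tau - 1\<close> were \<open>k * g d\<close>, comparing coefficients of the
  irrational \<open>tau\<close> would force \<open>k = 1\<close>, so
  \<open>g d = tau - 1 > 2 - tau\<close>.\<close>

lemma inverse_tau_div_g_not_int:
  assumes "d \<ge> 1" and "g d < 2 - tau"
  shows "(tau - 1) / g d \<notin> \<int>"
proof
  assume "(tau - 1) / g d \<in> \<int>"
  then obtain k :: int where k: "(tau - 1) / g d = of_int k" by (auto elim: Ints_cases)
  have gp: "g d > 0" using g_pos assms(1) by simp
  obtain s m where s: "real d * tau = of_int m + s" "\<bar>s\<bar> = g d" by (rule g_signed_step)
  have kg: "tau - 1 = k * g d" using k gp by (simp add: field_simps)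
  then have "0 < k * g d" using tau_bounds by linarith
  then have "k > 0" using gp by (simp add: zero_less_mult_iff)
  \<comment> \<open>The sign of \<open>s\<close> is moved into the multiplier.\<close>
  define t where "t = (if s \<ge> 0 then k else - k)"
  have "tau - 1 = t * s" using kg unfolding s(2)[symmetric] by (simp add: t_def)
  also have "\<dots> = t * (real d * tau) - t * m" using s(1) by (simp add: algebra_simps)
  finally have lin: "of_int (1 - t * int d) * tau = of_int (1 - t * m)"
    by (simp add: algebra_simps)
  have "1 - t * int d = 0"
  proof (rule ccontr)
    assume "1 - t * int d \<noteq> 0"
    then have "tau = of_int (1 - t * m) / of_int (1 - t * int d)"
      using lin by (simp add: field_simps del: of_int_diff of_int_mult)
    then show False using tau_irrational by (metis Rats_divide Rats_of_int)
  qed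
  then have "t * int d = 1" by simp
  then have "k = 1"
    using \<open>k > 0\<close> by (auto simp: t_def zmult_eq_1_iff split: if_splits)
  then show False using kg assms(2) tau_bounds by simp
qed

theorem theorem4p6:
  fixes d :: nat
  assumes "d \<ge> 1" and "g d < tau powi (-2)"
  shows "A d = enat (nat (\<lfloor>tau powi (-1) / g d\<rfloor> + 1)) \<and>
         \<lfloor>tau powi (-1) / g d\<rfloor> + 1 = \<lceil>tau powi (-1) / g d\<rceil>"
proof -
  have small: "g d < 2 - tau" using assms(2) by (simp add: tau_powi_m2)
  have gp: "g d > 0" using g_pos assms(1) by simp
  define c where "c = (tau - 1) / g d"
  have cp: "c > 0" using gp tau_bounds by (simp add: c_def)
  have ceil: "\<lfloor>c\<rfloor> + 1 = \<lceil>c\<rceil>"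
    using inverse_tau_div_g_not_int[OF assms(1) small] unfolding c_def
    by (metis ceiling_altdef Ints_of_int)
  have "(\<exists>i. is_MAP d l i) \<longleftrightarrow> 1 \<le> l \<and> l \<le> nat (\<lfloor>c\<rfloor> + 1)" for l
  proof -
    have "real (l - 1) * g d < tau - 1 \<longleftrightarrow> real (l - 1) < c"
      using gp by (simp add: c_def field_simps)
    \<comment> \<open>For an integer, \<open>l - 1 < c\<close> means
      \<open>l \<le> \<lceil>c\<rceil>\<close>; \<open>ceil\<close> turns this into the floor
      form.\<close>
    also have "\<dots> \<longleftrightarrow> l \<le> nat (\<lfloor>c\<rfloor> + 1)" if "l \<ge> 1"
      using that cp unfolding ceil by (simp add: le_nat_iff) linarith
    finally show ?thesis using MAP_length_less[OF small] MAP_exists[of l d]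
      by (metis is_MAP_def)
  qed
  then have "A d = Sup (enat ` {1..nat (\<lfloor>c\<rfloor> + 1)})"
    by (auto simp: A_def intro!: arg_cong[where f = Sup])
  also have "\<dots> = enat (nat (\<lfloor>c\<rfloor> + 1))"
    using cp by (intro antisym Sup_least Sup_upper) (auto simp: le_nat_iff)
  finally show ?thesis using ceil unfolding c_def tau_powi_m1 by blast
qed

end
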